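(* Let $A$ be a $2\times 2$ doubly nonnegative matrix with integer entries. Then $A$ has an integer cp-factorization; that is, there exist a positive integer $m$ and a $2\times m$ matrix $V$ with nonnegative integer entries such that $A=VV^T$.
   Context: A real symmetric matrix is called doubly nonnegative if it is positive semidefinite and all of its entries are nonnegative. An integer cp-factorization of an $n\times n$ matrix $A$ is a factorization $A=VV^T$, where $V$ is an $n\times m$ matrix (for some $m$, not necessarily equal to $n$) all of whose entries are nonnegative integers. *)

theory Defs
  imports Complex_Main "Jordan_Normal_Form.Matrix"
begin

definition positive_semidefinite_mat :: "real mat \<Rightarrow> bool" where
  "positive_semidefinite_mat A \<longleftrightarrow>
     square_mat A \<and> transpose_mat A = A \<and>
     (\<forall>x \<in> carrier_vec (dim_row A). 0 \<le> x \<bullet> (A *\<^sub>v x))"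

definition doubly_nonnegative_mat :: "real mat \<Rightarrow> bool" where
  "doubly_nonnegative_mat A \<longleftrightarrow>
     positive_semidefinite_mat A \<and> (\<forall>a \<in> elements_mat A. 0 \<le> a)"

(* V stays a real matrix, so that the product is the given real matrix A;
   \<nat> is the set of nonnegative integers inside the reals. *)
definition integer_cp_factorization :: "real mat \<Rightarrow> real mat \<Rightarrow> bool" where
  "integer_cp_factorization A V \<longleftrightarrow>
     dim_row V = dim_row A \<and> elements_mat V \<subseteq> \<nat> \<and> A = V * transpose_mat V"

end

theory Submission
  imports Defs
begin

text \<open>
  Write \<open>A\<close> as the symmetric matrix with diagonal entries \<open>a\<close>, \<open>c\<close> and off-diagonal entry \<open>b\<close>,
  all natural numbers with \<open>b\<^sup>2 \<le> a * c\<close>. Finding \<open>V\<close> means finding finitely many columns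
  \<open>(x, y)\<close> of natural numbers whose rank-one matrices sum to \<open>A\<close>.

  If \<open>b\<close> is at most both diagonal entries, then \<open>b\<close> columns \<open>(1, 1)\<close>, \<open>a - b\<close> columns \<open>(1, 0)\<close>
  and \<open>c - b\<close> columns \<open>(0, 1)\<close> will do. Otherwise one diagonal entry, say \<open>a\<close>, is smaller than
  \<open>b\<close>; it is positive since \<open>0 < b\<^sup>2 \<le> a * c\<close>. Subtracting the first
  row and column from the second yields the matrix with entries \<open>a\<close>, \<open>b - a\<close>, \<open>a - 2 * b + c\<close>. This congruence preserves the determinant and positive
  semidefiniteness, and the new off-diagonal entry is still nonnegative because \<open>a < b\<close>. A
  factorization of the new matrix gives one of the old matrix by adding the first row of the factor
  to its second row, an operation that keeps the factor nonnegative. Each such step lowers the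
  off-diagonal entry, so this variant of Gauss reduction of binary quadratic forms ends in the
  first case.
\<close>

text \<open>
  The numbers \<open>a\<close>, \<open>b\<close>, \<open>c\<close> are the entries of \<open>V * V\<^sup>T\<close> for the matrix \<open>V\<close> with column list
  \<open>cols\<close>. Lists let the number of columns vary freely, and concatenation adds Gram matrices.
\<close>

definition nat_gram :: "nat \<Rightarrow> nat \<Rightarrow> nat \<Rightarrow> bool" where
  "nat_gram a b c \<longleftrightarrow> (\<exists>cols :: (nat \<times> nat) list.
     (\<Sum>(x, y)\<leftarrow>cols. x * x) = a \<and> (\<Sum>(x, y)\<leftarrow>cols. x * y) = b \<and> (\<Sum>(x, y)\<leftarrow>cols. y * y) = c)"

lemma nat_gram_swap:
  assumes "nat_gram a b c"
  shows "nat_gram c b a"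
proof -
  obtain cols :: "(nat \<times> nat) list" where
    "(\<Sum>(x, y)\<leftarrow>cols. x * x) = a" "(\<Sum>(x, y)\<leftarrow>cols. x * y) = b" "(\<Sum>(x, y)\<leftarrow>cols. y * y) = c"
    using assms unfolding nat_gram_def by blast
  then show ?thesis
    unfolding nat_gram_def
    by (intro exI[of _ "map prod.swap cols"]) (simp add: case_prod_unfold o_def mult.commute)
qed

lemma nat_gram_diagonally_dominant:
  assumes "b \<le> a" "b \<le> c"
  shows "nat_gram a b c"
  unfolding nat_gram_def using assms
  by (intro exI[of _ "replicate b (1, 1) @ replicate (a - b) (1, 0) @ replicate (c - b) (0, 1)"])
     (simp add: sum_list_replicate)

text \<open>Adding the first row of the factor to its second row is what undoes a reduction step.\<close>

lemma nat_gram_add_row: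
  assumes "nat_gram a b c"
  shows "nat_gram a (a + b) (a + 2 * b + c)"
proof -
  obtain cols :: "(nat \<times> nat) list" where
    "(\<Sum>(x, y)\<leftarrow>cols. x * x) = a" "(\<Sum>(x, y)\<leftarrow>cols. x * y) = b" "(\<Sum>(x, y)\<leftarrow>cols. y * y) = c"
    using assms unfolding nat_gram_def by blast
  moreover have "(\<Sum>(x, y)\<leftarrow>cols. x * (x + y)) = (\<Sum>(x, y)\<leftarrow>cols. x * x) + (\<Sum>(x, y)\<leftarrow>cols. x * y)"
    by (induction cols) (auto simp: algebra_simps)
  moreover have "(\<Sum>(x, y)\<leftarrow>cols. (x + y) * (x + y)) =
      (\<Sum>(x, y)\<leftarrow>cols. x * x) + 2 * (\<Sum>(x, y)\<leftarrow>cols. x * y) + (\<Sum>(x, y)\<leftarrow>cols. y * y)"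
    by (induction cols) (auto simp: algebra_simps)
  ultimately show ?thesis
    unfolding nat_gram_def
    by (intro exI[of _ "map (\<lambda>(x, y). (x, x + y)) cols"]) (simp add: case_prod_unfold o_def)
qed

text \<open>
  The reduced matrix has natural entries again: its last entry \<open>d = a - 2 * b + c\<close> is nonnegative
  by the inequality of arithmetic and geometric means, \<open>2 * b \<le> 2 * sqrt (a * c) \<le> a + c\<close>.
\<close>

lemma reduction_step:
  fixes a b c :: nat
  assumes "a < b" "b\<^sup>2 \<le> a * c"
  obtains d where "c = a + 2 * (b - a) + d" "(b - a)\<^sup>2 \<le> a * d"
proof -
  have "int b ^ 2 \<le> int a * int c"
    using assms(2) by (metis of_nat_le_iff of_nat_mult of_nat_power)
  moreover have "(2 * int b)\<^sup>2 = 4 * int b ^ 2" 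
    by (simp add: power2_eq_square)
  moreover have "(int a + int c)\<^sup>2 = 4 * (int a * int c) + (int a - int c)\<^sup>2"
    by (simp add: power2_eq_square algebra_simps)
  moreover have "0 \<le> (int a - int c)\<^sup>2" by simp
  ultimately have "(2 * int b)\<^sup>2 \<le> (int a + int c)\<^sup>2" by linarith
  then have "2 * int b \<le> int a + int c"
    by (rule power2_le_imp_le) simp
  then obtain d where d: "a + c = 2 * b + d"
    by (metis le_Suc_ex of_nat_add of_nat_le_iff of_nat_mult of_nat_numeral)
  obtain k where k: "b = a + k" using assms(1) less_imp_add_positive by blast
  have c: "c = a + 2 * k + d" using d k by simp
  have "k\<^sup>2 \<le> a * d"
    using assms(2) unfolding c k by (simp add: power2_eq_square algebra_simps)
  with c k show ?thesis by (intro that[of d]) simp_all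
qed

lemma nat_gram_if_det_nonneg:
  fixes a b c :: nat
  assumes "b\<^sup>2 \<le> a * c"
  shows "nat_gram a b c"
  using assms
proof (induction b arbitrary: a c rule: less_induct)
  case (less b)
  have reduce: "nat_gram p b q" if "p < b" "b\<^sup>2 \<le> p * q" for p q
  proof -
    obtain d where d: "q = p + 2 * (b - p) + d" "(b - p)\<^sup>2 \<le> p * d"
      using reduction_step[OF \<open>p < b\<close> \<open>b\<^sup>2 \<le> p * q\<close>] .
    \<comment> \<open>The off-diagonal entry drops strictly only for \<open>p > 0\<close>, which \<open>0 < b\<^sup>2 \<le> p * q\<close> forces.\<close>
    have "p \<noteq> 0" using that by (intro notI) simp
    then have "b - p < b" using \<open>p < b\<close> by simp
    from nat_gram_add_row[OF less.IH[OF this d(2)]] show ?thesis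
      using \<open>p < b\<close> d(1) by simp
  qed
  consider "a < b" | "c < b" | "b \<le> a" "b \<le> c" by linarith
  then show ?case
  proof cases
    case 1
    then show ?thesis using reduce less.prems by blast
  next
    case 2
    then show ?thesis using reduce[of c a] less.prems nat_gram_swap by (simp add: mult.commute)
  next
    case 3
    then show ?thesis by (rule nat_gram_diagonally_dominant)
  qed
qed

lemma det_nonneg_if_form_nonneg:
  fixes a b c :: real
  assumes form: "\<And>x y. 0 \<le> a * x\<^sup>2 + 2 * b * x * y + c * y\<^sup>2" and "0 \<le> a"
  shows "b\<^sup>2 \<le> a * c"
proof (cases "a = 0")
  case True
  \<comment> \<open>The form is linear in \<open>x\<close> at \<open>y = 1\<close>; if \<open>b \<noteq> 0\<close>, this \<open>x\<close> gives it the value \<open>-1\<close>.\<close>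
  have "b = 0"
    using form[of "- (c + 1) / (2 * b)" 1] True by (cases "b = 0") (simp_all add: field_simps)
  with True show ?thesis by simp
next
  case False
  \<comment> \<open>The form is minimal on the line \<open>y = - a\<close> at \<open>x = b\<close>, with value \<open>a\<close> times the determinant.\<close>
  have "0 \<le> a * (a * c - b\<^sup>2)"
    using form[of b "- a"] by (simp add: power2_eq_square algebra_simps)
  with False \<open>0 \<le> a\<close> show ?thesis by (simp add: zero_le_mult_iff)
qed

lemma quadratic_form_2:
  fixes A :: "real mat"
  assumes "A \<in> carrier_mat 2 2"
  shows "vec_of_list [x, y] \<bullet> (A *\<^sub>v vec_of_list [x, y]) =
    A $$ (0, 0) * x\<^sup>2 + (A $$ (0, 1) + A $$ (1, 0)) * x * y + A $$ (1, 1) * y\<^sup>2"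
  using assms
  by (auto simp: scalar_prod_def numeral_2_eq_2 power2_eq_square algebra_simps vec_of_list_index)

lemma gram_entry_from_columns:
  fixes cols :: "(nat \<times> nat) list"
  defines "V \<equiv> mat 2 (length cols)
    (\<lambda>(i, k). real (if i = 0 then fst (cols ! k) else snd (cols ! k)))"
  assumes "i < 2" "j < 2"
  shows "(V * transpose_mat V) $$ (i, j) = real (\<Sum>(x, y)\<leftarrow>cols.
    (if i = 0 then x else y) * (if j = 0 then x else y))"
  using assms(2,3)
  by (simp add: V_def scalar_prod_def sum_list_sum_nth case_prod_unfold atLeast0LessThan
      cong: if_cong)

theorem theorem2p1:
  fixes A :: "real mat"
  assumes "A \<in> carrier_mat 2 2"
    and "doubly_nonnegative_mat A"
    and "elements_mat A \<subseteq> \<int>"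
  shows "\<exists>(m::nat) V. 0 < m \<and> V \<in> carrier_mat 2 m \<and> integer_cp_factorization A V"
proof -
  have entry: "\<exists>n::nat. A $$ (i, j) = real n" if "i < 2" "j < 2" for i j
  proof -
    have "A $$ (i, j) \<in> elements_mat A" using assms(1) that by auto
    then have "A $$ (i, j) \<in> \<int>" "0 \<le> A $$ (i, j)"
      using assms(2,3) unfolding doubly_nonnegative_mat_def by auto
    then show ?thesis by (metis Ints_cases of_int_0_le_iff of_int_of_nat_eq zero_le_imp_eq_int)
  qed
  obtain a b c :: nat where
    abc: "A $$ (0, 0) = real a" "A $$ (0, 1) = real b" "A $$ (1, 1) = real c"
    using entry[of 0 0] entry[of 0 1] entry[of 1 1] by auto
  have psd: "transpose_mat A = A" "\<forall>x \<in> carrier_vec 2. 0 \<le> x \<bullet> (A *\<^sub>v x)"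
    using assms(1,2) unfolding doubly_nonnegative_mat_def positive_semidefinite_mat_def by auto
  have "transpose_mat A $$ (1, 0) = A $$ (0, 1)" using assms(1) by simp
  then have A10: "A $$ (1, 0) = real b" unfolding psd(1) abc(2) .
  have "0 \<le> real a * x\<^sup>2 + 2 * real b * x * y + real c * y\<^sup>2" for x y :: real
  proof -
    have "vec_of_list [x, y] \<in> carrier_vec 2" by (rule carrier_vecI) simp
    with psd(2) have "0 \<le> vec_of_list [x, y] \<bullet> (A *\<^sub>v vec_of_list [x, y])" by (rule bspec)
    also have "\<dots> = real a * x\<^sup>2 + (real b + real b) * x * y + real c * y\<^sup>2"
      using quadratic_form_2[OF assms(1)] unfolding abc A10 .
    finally show ?thesis unfolding mult_2 .
  qed
  then have "(real b)\<^sup>2 \<le> real a * real c" by (rule det_nonneg_if_form_nonneg) simp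
  then have "b\<^sup>2 \<le> a * c" by (metis of_nat_le_iff of_nat_mult of_nat_power)
  then obtain cols' :: "(nat \<times> nat) list" where cols':
    "(\<Sum>(x, y)\<leftarrow>cols'. x * x) = a" "(\<Sum>(x, y)\<leftarrow>cols'. x * y) = b" "(\<Sum>(x, y)\<leftarrow>cols'. y * y) = c"
    using nat_gram_if_det_nonneg unfolding nat_gram_def by blast
  \<comment> \<open>For \<open>A = 0\<close> the column list may be empty; a zero column makes the number of columns positive.\<close>
  define cols where "cols = (0, 0) # cols'"
  define V where "V = mat 2 (length cols)
    (\<lambda>(i, k). real (if i = 0 then fst (cols ! k) else snd (cols ! k)))"
  have "A = V * transpose_mat V"
  proof (rule eq_matI)
    fix i j assume "i < dim_row (V * transpose_mat V)" "j < dim_col (V * transpose_mat V)"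
    then have ij: "i < 2" "j < 2" by (simp_all add: V_def)
    then have "i = 0 \<or> i = 1" "j = 0 \<or> j = 1" by auto
    then show "A $$ (i, j) = (V * transpose_mat V) $$ (i, j)"
      unfolding V_def gram_entry_from_columns[OF ij]
      using abc A10 cols' by (auto simp: cols_def mult.commute)
  qed (use assms(1) in \<open>auto simp: V_def\<close>)
  moreover have "elements_mat V \<subseteq> \<nat>" by (auto simp: V_def)
  ultimately have "integer_cp_factorization A V"
    using assms(1) unfolding integer_cp_factorization_def by (simp add: V_def)
  moreover have "V \<in> carrier_mat 2 (length cols)" "0 < length cols"
    by (simp_all add: V_def cols_def)
  ultimately show ?thesis by blast
qed

end
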